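(* Let $\alpha\in(0,2)$ and suppose that for some $\alpha_0\in(0,\alpha/2)$, $$\limsup_{|x|\to\infty}\bigg[\Big(\sup_{|z|\ge|x|}e^{-V(z)}\Big)|x|^{d+\alpha-\alpha_0}\bigg]=0.$$ Then there exists a constant $C_2>0$ such that for all $f\in C_b^\infty(\mathbb R^d)$, $$\int\big(f(x)-\mu_V(f)\big)^2\,\omega(x)\,\mu_V(dx)\le C_2 D_{\alpha,V}(f,f),\qquad \omega(x):=\frac{e^{V(x)}}{(1+|x|)^{d+\alpha}}.$$ Moreover, $\omega$ is optimal in the following sense: if $\omega^*$ is a positive function on $\mathbb R^d$ with $\liminf_{|x|\to\infty}\omega^*(x)/\omega(x)=\infty$, then there is no constant $C>0$ such that $\int(f-\mu_V(f))^2\omega^*\,d\mu_V\le C D_{\alpha,V}(f,f)$ for all $f\in C_b^\infty(\mathbb R^d)$.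
   Context: Let $d\ge1$. $V:\mathbb R^d\to\mathbb R$ is a locally bounded measurable function such that $e^{-V}$ is bounded and $\int e^{-V(x)}dx<\infty$; $\mu_V(dx)=\frac{e^{-V(x)}}{\int e^{-V(y)}dy}dx$, and $\mu_V(f)=\int f\,d\mu_V$. $C_b^\infty(\mathbb R^d)$ is the set of smooth functions on $\mathbb R^d$ that are bounded together with all their derivatives. For $\alpha\in(0,2)$, $$D_{\alpha,V}(f,f):=\iint\frac{(f(y)-f(x))^2}{|y-x|^{d+\alpha}}\,dy\,\mu_V(dx).$$ *)

theory Defs
  imports "HOL-Analysis.Analysis"
begin

fun dderiv :: "'a::euclidean_space list \<Rightarrow> ('a \<Rightarrow> real) \<Rightarrow> 'a \<Rightarrow> real" where
  "dderiv [] f = f"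
| "dderiv (v # vs) f = (\<lambda>x. frechet_derivative (dderiv vs f) (at x) v)"

text \<open>C_b^infinity: smooth, bounded together with all partial derivatives of every order.
  All iterated partial derivatives are required to exist as Frechet-differentiable functions
  everywhere (hence continuous), which is exactly smoothness.\<close>
definition Cb_inf :: "('a::euclidean_space \<Rightarrow> real) \<Rightarrow> bool" where
  "Cb_inf f \<longleftrightarrow> (\<forall>vs. set vs \<subseteq> Basis \<longrightarrow>
      (\<forall>x. dderiv vs f differentiable (at x)) \<and> bounded (range (dderiv vs f)))"

definition ZV :: "('a::euclidean_space \<Rightarrow> real) \<Rightarrow> real" where
  "ZV V = integral\<^sup>L lborel (\<lambda>y. exp (- V y))"

definition muV :: "('a::euclidean_space \<Rightarrow> real) \<Rightarrow> 'a measure" where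
  "muV V = density lborel (\<lambda>x. ennreal (exp (- V x) / ZV V))"

definition muV_f :: "('a::euclidean_space \<Rightarrow> real) \<Rightarrow> ('a \<Rightarrow> real) \<Rightarrow> real" where
  "muV_f V f = integral\<^sup>L (muV V) f"

definition D_form :: "real \<Rightarrow> ('a::euclidean_space \<Rightarrow> real) \<Rightarrow> ('a \<Rightarrow> real) \<Rightarrow> ennreal" where
  "D_form \<alpha> V f = (\<integral>\<^sup>+ x. (\<integral>\<^sup>+ y. ennreal ((f y - f x)\<^sup>2 / norm (y - x) powr (real DIM('a) + \<alpha>)) \<partial>lborel) \<partial>muV V)"

definition omega :: "real \<Rightarrow> ('a::euclidean_space \<Rightarrow> real) \<Rightarrow> 'a \<Rightarrow> real" where
  "omega \<alpha> V x = exp (V x) / (1 + norm x) powr (real DIM('a) + \<alpha>)"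

end

theory Submission
  imports Defs
begin

text \<open>Write \<open>p = d + \<alpha>\<close>, \<open>q x = (1 + norm x) powr (- p)\<close> and \<open>w\<close> for the density of \<open>\<mu>\<close>, so that the weighted
  variance is a multiple of \<open>H = \<integral> (f - \<mu> f)\<^sup>2 q\<close>. For each fixed \<open>y\<close>, Cauchy--Schwarz bounds \<open>H\<close> by a
  constant times \<open>\<integral> (f x - f y)\<^sup>2 q x dx\<close>; the constant involves \<open>\<integral> w\<^sup>2 / q\<close>, which is finite precisely
  because \<open>2 * \<alpha>0 < \<alpha>\<close>. For \<open>norm y \<le> 1\<close> one has \<open>norm (x - y) \<le> 1 + norm x\<close>, so the weight \<open>q x\<close> is
  dominated by the kernel of \<open>D\<close>, and averaging over the unit ball with respect to \<open>\<mu>\<close> gives the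
  inequality.

  For the optimality take \<open>f x = sin ((x \<bullet> e) / R)\<close> with a unit vector \<open>e\<close>: its energy is
  \<open>O(R powr (- \<alpha>))\<close>, its mean tends to \<open>0\<close>, and it is at least \<open>1/2\<close> on a ball of radius \<open>R / 2\<close> at
  distance at least \<open>R\<close> from the origin, whose contribution to \<open>\<integral> f\<^sup>2 q\<close> is of order
  \<open>R powr (- \<alpha>)\<close> as well. A weight of larger order than \<open>\<omega>\<close> therefore violates the inequality.\<close>

section \<open>Radial integrals and power weights\<close>

text \<open>Replaces polar coordinates: \<open>m r / r powr p\<close> is at most a constant times the integral of
  \<open>m t * t powr (- p - 1)\<close> over \<open>r \<le> t \<le> 2 * r\<close>, and Tonelli then integrates over balls of radius \<open>t\<close>.\<close>
lemma nn_integral_radial_le: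
  fixes m :: "real \<Rightarrow> real" and \<beta> :: real
  assumes [measurable]: "m \<in> borel_measurable borel"
    and nonneg: "\<And>t. 0 \<le> m t"
    and mono: "\<And>s t. 0 < s \<Longrightarrow> s \<le> t \<Longrightarrow> m s \<le> m t"
    and \<beta>: "0 < \<beta>"
  shows "(\<integral>\<^sup>+ z. ennreal (m (norm z) / norm z powr (real DIM('a::euclidean_space) + \<beta>)) \<partial>(lborel :: 'a measure))
    \<le> ennreal (2 powr (real DIM('a) + \<beta> + 1) * unit_ball_vol (real DIM('a)))
       * (\<integral>\<^sup>+ t. ennreal (m t * t powr (- \<beta> - 1)) * indicator {0<..} t \<partial>lborel)"
proof -
  define p where "p = real DIM('a) + \<beta>"
  have p: "0 < p" using \<beta> by (simp add: p_def add_nonneg_pos)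
  define k where "k = (\<lambda>t. m t * t powr (- p - 1))"
  have k_nonneg: "0 \<le> k t" for t by (simp add: k_def nonneg)
  have [measurable]: "k \<in> borel_measurable borel" by (simp add: k_def)
  have pointwise: "ennreal (m (norm z) / norm z powr p) \<le>
      (\<integral>\<^sup>+ t. ennreal (2 powr (p + 1)) * (ennreal (k t) * indicator {0<..} t * indicator {..t} (norm z)) \<partial>lborel)"
    for z :: 'a
  \<comment> \<open>At \<open>z = 0\<close> the left side is \<open>0\<close>, because
    \<open>0 powr p = 0\<close> and division by zero yields \<open>0\<close>.\<close>
  proof (cases "z = 0")
    case False
    define r where "r = norm z"
    have r: "0 < r" using False by (simp add: r_def)
    \<comment> \<open>On \<open>{r..2*r}\<close> the function \<open>k\<close> is at least
      \<open>m r * (2 * r) powr (- p - 1)\<close>, as \<open>m\<close> increases and the power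
      decreases. That value times the length \<open>r\<close> of the interval is
      \<open>m r / r powr p\<close> up to the factor \<open>2 powr (p + 1)\<close>, which is where
      the constant comes from.\<close>
    have "ennreal (m r / r powr p) = ennreal (2 powr (p + 1) * (m r * (2 * r) powr (- p - 1))) * ennreal r"
    proof -
      have "(2 * r) powr (- p - 1) = 2 powr (- p - 1) * (r powr (- p) * r powr (- 1))"
        using r powr_add [of r "-p" "-1"] by (simp add: powr_mult)
      then have "2 powr (p + 1) * (m r * (2 * r) powr (- p - 1)) * r = (2 powr (p + 1) * 2 powr (- p - 1)) * m r * r powr (-p) * (r powr (-1) * r)"
        by (simp only: ac_simps)
      also have "2 powr (p + 1) * 2 powr (- p - 1) = (1::real)" by (simp add: powr_add [symmetric])
      also have "r powr (-1) * r = 1" using r by (simp add: powr_minus)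
      finally have "m r / r powr p = 2 powr (p + 1) * (m r * (2 * r) powr (- p - 1)) * r"
        by (simp add: powr_minus divide_simps)
      then show ?thesis using r by (simp add: ennreal_mult'' [symmetric])
    qed
    also have "\<dots> = (\<integral>\<^sup>+ t. ennreal (2 powr (p + 1) * (m r * (2 * r) powr (- p - 1))) * indicator {r..2*r} t \<partial>lborel)"
      using r by (simp add: nn_integral_cmult_indicator)
    also have "\<dots> \<le> (\<integral>\<^sup>+ t. ennreal (2 powr (p + 1)) * (ennreal (k t) * indicator {0<..} t * indicator {..t} r) \<partial>lborel)"
    proof (intro nn_integral_mono)
      fix t :: real
      show "ennreal (2 powr (p + 1) * (m r * (2 * r) powr (- p - 1))) * indicator {r..2*r} t
        \<le> ennreal (2 powr (p + 1)) * (ennreal (k t) * indicator {0<..} t * indicator {..t} r)"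
      proof (cases "t \<in> {r..2*r}")
        case True
        then have t: "0 < t" "r \<le> t" "t \<le> 2 * r" using r by auto
        have "m r * (2 * r) powr (- p - 1) \<le> k t"
          unfolding k_def using t p r
          by (intro mult_mono mono powr_mono2' nonneg) auto
        then show ?thesis using t
          by (simp add: ennreal_mult' [symmetric] mult_left_mono ennreal_leI)
      qed simp
    qed
    finally show ?thesis by (simp add: r_def)
  qed simp
  have "(\<integral>\<^sup>+ z. ennreal (m (norm z) / norm z powr p) \<partial>(lborel :: 'a measure))
    \<le> (\<integral>\<^sup>+ z. \<integral>\<^sup>+ t. ennreal (2 powr (p + 1)) * (ennreal (k t) * indicator {0<..} t * indicator {..t} (norm z)) \<partial>lborel \<partial>(lborel :: 'a measure))"
    by (intro nn_integral_mono pointwise)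
  also have "\<dots> = (\<integral>\<^sup>+ t. \<integral>\<^sup>+ z. ennreal (2 powr (p + 1)) * (ennreal (k t) * indicator {0<..} t * indicator {..t} (norm z)) \<partial>(lborel :: 'a measure) \<partial>lborel)"
    by (intro lborel_pair.Fubini') (simp add: indicator_def)
  also have "\<dots> = (\<integral>\<^sup>+ t. ennreal (2 powr (p + 1) * unit_ball_vol (real DIM('a)))
                        * (ennreal (m t * t powr (- \<beta> - 1)) * indicator {0<..} t) \<partial>lborel)"
  proof (intro nn_integral_cong)
    fix t :: real
    show "(\<integral>\<^sup>+ z. ennreal (2 powr (p + 1)) * (ennreal (k t) * indicator {0<..} t * indicator {..t} (norm z)) \<partial>(lborel :: 'a measure))
      = ennreal (2 powr (p + 1) * unit_ball_vol (real DIM('a))) * (ennreal (m t * t powr (- \<beta> - 1)) * indicator {0<..} t)"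
    proof (cases "0 < t")
      case True
      have ind: "indicator {..t} (norm z) = (indicator (cball 0 t) z :: ennreal)" for z :: 'a
        by (auto simp: indicator_def)
      \<comment> \<open>The volume of the ball contributes \<open>t ^ DIM('a)\<close>, which cancels
        the dimension contained in \<open>p\<close>.\<close>
      have pw: "t powr (- p - 1) * t ^ DIM('a) = t powr (- \<beta> - 1)"
        using True by (simp add: powr_realpow [symmetric] powr_add [symmetric] p_def)
      have "(\<integral>\<^sup>+ z. ennreal (2 powr (p + 1)) * (ennreal (k t) * indicator {0<..} t * indicator {..t} (norm z)) \<partial>(lborel :: 'a measure))
        = (\<integral>\<^sup>+ z. ennreal (2 powr (p + 1) * k t) * indicator (cball 0 t) z \<partial>(lborel :: 'a measure))"
        using True by (simp add: ind ennreal_mult' k_nonneg mult.assoc)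
      also have "\<dots> = ennreal (2 powr (p + 1) * k t) * ennreal (unit_ball_vol (real DIM('a)) * t ^ DIM('a))"
        using True by (simp add: nn_integral_cmult_indicator emeasure_cball)
      also have "\<dots> = ennreal (2 powr (p + 1) * unit_ball_vol (real DIM('a)) * (m t * (t powr (- p - 1) * t ^ DIM('a))))"
        using True by (subst ennreal_mult'' [symmetric]) (simp_all add: k_def ac_simps)
      also have "\<dots> = ennreal (2 powr (p + 1) * unit_ball_vol (real DIM('a))) * ennreal (m t * t powr (- \<beta> - 1))"
        unfolding pw by (simp add: ennreal_mult'' nonneg)
      finally show ?thesis using True by simp
    qed simp
  qed
  also have "\<dots> = ennreal (2 powr (p + 1) * unit_ball_vol (real DIM('a)))
     * (\<integral>\<^sup>+ t. ennreal (m t * t powr (- \<beta> - 1)) * indicator {0<..} t \<partial>lborel)"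
    by (intro nn_integral_cmult) simp
  finally show ?thesis by (simp add: p_def)
qed

text \<open>The integral splits at \<open>t = R\<close>. Below \<open>R\<close> the square leaves
  \<open>t powr (1 - \<alpha>)\<close>, integrable at \<open>0\<close> because \<alpha> < 2; above
  \<open>R\<close> the constant 4 leaves \<open>t powr (- \<alpha> - 1)\<close>, integrable at
  infinity because \<alpha> > 0. Both pieces scale like \<open>R powr (- \<alpha>)\<close>.\<close>

lemma nn_integral_min_square_powr_le:
  fixes \<alpha> R :: real
  assumes \<alpha>: "0 < \<alpha>" "\<alpha> < 2" and R: "0 < R"
  shows "(\<integral>\<^sup>+ t. ennreal (min ((t / R)\<^sup>2) 4 * t powr (- \<alpha> - 1)) * indicator {0<..} t \<partial>lborel)
    \<le> ennreal ((1 / (2 - \<alpha>) + 4 / \<alpha>) * R powr (- \<alpha>))"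
proof -
  have "(\<integral>\<^sup>+ t. ennreal (min ((t / R)\<^sup>2) 4 * t powr (- \<alpha> - 1)) * indicator {0<..} t \<partial>lborel)
    \<le> (\<integral>\<^sup>+ t. ennreal (1 / R\<^sup>2) * (ennreal (t powr (1 - \<alpha>)) * indicator {0..R} t)
        + ennreal 4 * (ennreal (t powr (- \<alpha> - 1)) * indicator {R..} t) \<partial>lborel)"
  proof (intro nn_integral_mono)
    fix t :: real
    consider "t \<le> 0" | "0 < t" "t < R" | "R \<le> t" by linarith
    then show "ennreal (min ((t / R)\<^sup>2) 4 * t powr (- \<alpha> - 1)) * indicator {0<..} t
      \<le> ennreal (1 / R\<^sup>2) * (ennreal (t powr (1 - \<alpha>)) * indicator {0..R} t)
        + ennreal 4 * (ennreal (t powr (- \<alpha> - 1)) * indicator {R..} t)"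
    proof cases
      case 2
      have "(t / R)\<^sup>2 * t powr (- \<alpha> - 1) = 1 / R\<^sup>2 * (t powr 2 * t powr (- \<alpha> - 1))"
        using 2 by (simp add: power_divide)
      also have "t powr 2 * t powr (- \<alpha> - 1) = t powr (1 - \<alpha>)"
        by (simp add: powr_add [symmetric])
      finally have "min ((t / R)\<^sup>2) 4 * t powr (- \<alpha> - 1) \<le> 1 / R\<^sup>2 * t powr (1 - \<alpha>)"
        by (metis min.cobounded1 mult_right_mono powr_ge_zero)
      then have "ennreal (min ((t / R)\<^sup>2) 4 * t powr (- \<alpha> - 1)) \<le> ennreal (1 / R\<^sup>2) * ennreal (t powr (1 - \<alpha>))"
        by (metis ennreal_leI ennreal_mult' zero_le_divide_1_iff zero_le_power2)
      then show ?thesis using 2 by simp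
    next
      case 3
      have "min ((t / R)\<^sup>2) 4 * t powr (- \<alpha> - 1) \<le> 4 * t powr (- \<alpha> - 1)"
        by (intro mult_right_mono) auto
      then have "ennreal (min ((t / R)\<^sup>2) 4 * t powr (- \<alpha> - 1)) \<le> ennreal 4 * ennreal (t powr (- \<alpha> - 1))"
        by (metis ennreal_leI ennreal_mult' zero_le_numeral)
      then show ?thesis using 3 R by (simp add: add_increasing)
    qed simp
  qed
  also have "\<dots> = ennreal (1 / R\<^sup>2) * ennreal (R powr (2 - \<alpha>) / (2 - \<alpha>)) + ennreal 4 * ennreal (R powr (- \<alpha>) / \<alpha>)"
    using nn_integral_has_integral_lebesgue' [OF _ has_integral_powr_from_0 [of "1 - \<alpha>" R]]
      nn_integral_has_integral_lebesgue' [OF _ has_integral_powr_to_inf [of "- \<alpha> - 1" R]] \<alpha> R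
    by (simp add: nn_integral_add nn_integral_cmult)
  also have "\<dots> = ennreal (1 / R\<^sup>2 * (R powr (2 - \<alpha>) / (2 - \<alpha>)) + 4 * (R powr (- \<alpha>) / \<alpha>))"
    using \<alpha> by (simp add: ennreal_mult' ennreal_plus del: times_divide_eq_left times_divide_eq_right)
  also have "R powr (2 - \<alpha>) = R\<^sup>2 * R powr (- \<alpha>)"
    using R by (simp add: powr_diff powr_minus divide_simps)
  finally show ?thesis using R by (simp add: algebra_simps)
qed

text \<open>The function is at most 1 on the unit ball and at most \<open>norm x powr (- p)\<close>
  outside it. The cut-off \<open>m\<close> is nondecreasing, so \<open>nn_integral_radial_le\<close>
  reduces the outer part to the integral of \<open>t powr (- \<beta> - 1)\<close> over
  \<open>{1..}\<close>.\<close>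

lemma integrable_one_plus_norm_powr:
  fixes \<beta> :: real
  assumes \<beta>: "0 < \<beta>"
  shows "integrable lborel (\<lambda>x::'a::euclidean_space. (1 + norm x) powr (- (real DIM('a) + \<beta>)))"
proof -
  define p where "p = real DIM('a) + \<beta>"
  have p: "0 < p" using \<beta> by (simp add: p_def add_nonneg_pos)
  define m :: "real \<Rightarrow> real" where "m = indicator {1..}"
  have [measurable]: "m \<in> borel_measurable borel" by (simp add: m_def)
  have "(\<integral>\<^sup>+ x. ennreal ((1 + norm x) powr (- p)) \<partial>(lborel :: 'a measure))
    \<le> (\<integral>\<^sup>+ x. indicator (cball 0 1) x + ennreal (m (norm x) / norm x powr p) \<partial>(lborel :: 'a measure))"
  proof (intro nn_integral_mono)
    fix x :: 'a
    show "ennreal ((1 + norm x) powr (- p)) \<le> indicator (cball 0 1) x + ennreal (m (norm x) / norm x powr p)"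
    proof (cases "norm x \<le> 1")
      case True
      have "(1 + norm x) powr (- p) \<le> 1 powr (- p)"
        using p by (intro powr_mono2') auto
      then show ?thesis using True by (simp add: add_increasing2 ennreal_le_1)
    next
      case False
      then have "(1 + norm x) powr (- p) \<le> norm x powr (- p)"
        using p by (intro powr_mono2') auto
      then show ?thesis using False
        by (simp add: m_def powr_minus divide_simps ennreal_leI)
    qed
  qed
  also have "\<dots> = emeasure lborel (cball (0::'a) 1) + (\<integral>\<^sup>+ x. ennreal (m (norm x) / norm x powr p) \<partial>(lborel :: 'a measure))"
  proof (subst nn_integral_add)
    show "(indicator (cball 0 1) :: 'a \<Rightarrow> ennreal) \<in> borel_measurable lborel"
      by (intro borel_measurable_indicator) simp
  qed simp_all
  also have "\<dots> < \<infinity>"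
  proof -
    have "(\<integral>\<^sup>+ t. ennreal (m t * t powr (- \<beta> - 1)) * indicator {0<..} t \<partial>lborel)
      = (\<integral>\<^sup>+ t. ennreal (t powr (- \<beta> - 1)) * indicator {1..} t \<partial>lborel)"
      by (intro nn_integral_cong) (auto simp: m_def indicator_def)
    also have "\<dots> < \<infinity>"
      using nn_integral_has_integral_lebesgue' [OF _ has_integral_powr_to_inf [of "- \<beta> - 1" 1]] \<beta> by simp
    finally have "ennreal (2 powr (real DIM('a) + \<beta> + 1) * unit_ball_vol (real DIM('a)))
       * (\<integral>\<^sup>+ t. ennreal (m t * t powr (- \<beta> - 1)) * indicator {0<..} t \<partial>lborel) < \<infinity>" (is "?bound < \<infinity>")
      by (simp add: ennreal_mult_less_top)
    moreover have "(\<integral>\<^sup>+ x. ennreal (m (norm x) / norm x powr p) \<partial>(lborel :: 'a measure)) \<le> ?bound"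
      unfolding p_def using \<beta> by (intro nn_integral_radial_le) (auto simp: m_def indicator_def)
    ultimately show ?thesis
      by (auto simp: emeasure_cball intro: le_less_trans)
  qed
  finally show ?thesis
    by (intro integrableI_nonneg) (auto simp: p_def)
qed

section \<open>Cauchy--Schwarz inequality\<close>

text \<open>The integral of \<open>(s * f x - g x)\<^sup>2\<close> is a quadratic polynomial in
  \<open>s\<close> that is never negative; evaluating it at a well chosen \<open>s\<close> gives the
  inequality.\<close>

lemma integral_Cauchy_Schwarz:
  fixes f g :: "'a \<Rightarrow> real"
  assumes [measurable]: "f \<in> borel_measurable M" "g \<in> borel_measurable M"
    and f2: "integrable M (\<lambda>x. (f x)\<^sup>2)" and g2: "integrable M (\<lambda>x. (g x)\<^sup>2)"
  shows "integrable M (\<lambda>x. f x * g x)"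
    and "(\<integral>x. f x * g x \<partial>M)\<^sup>2 \<le> (\<integral>x. (f x)\<^sup>2 \<partial>M) * (\<integral>x. (g x)\<^sup>2 \<partial>M)"
proof -
  have "\<bar>f x * g x\<bar> \<le> (f x)\<^sup>2 + (g x)\<^sup>2" for x
    using sum_squares_bound [of "\<bar>f x\<bar>" "\<bar>g x\<bar>"] mult_nonneg_nonneg [of "\<bar>f x\<bar>" "\<bar>g x\<bar>"]
    unfolding abs_mult power2_abs by linarith
  then show fg: "integrable M (\<lambda>x. f x * g x)"
    by (intro Bochner_Integration.integrable_bound [OF Bochner_Integration.integrable_add [OF f2 g2]]) auto
  define F G P where "F = (\<integral>x. (f x)\<^sup>2 \<partial>M)" and "G = (\<integral>x. (g x)\<^sup>2 \<partial>M)" and "P = (\<integral>x. f x * g x \<partial>M)"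
  have quad: "0 \<le> s\<^sup>2 * F - 2 * s * P + G" for s
  proof -
    have "0 \<le> (\<integral>x. (s * f x - g x)\<^sup>2 \<partial>M)" by simp
    also have "\<dots> = (\<integral>x. s\<^sup>2 * (f x)\<^sup>2 - (2 * s) * (f x * g x) + (g x)\<^sup>2 \<partial>M)"
      by (simp add: power2_eq_square algebra_simps)
    also have "\<dots> = s\<^sup>2 * F - 2 * s * P + G"
      using f2 g2 fg by (simp add: F_def G_def P_def)
    finally show ?thesis .
  qed
  have "0 \<le> F" by (simp add: F_def)
  have "P\<^sup>2 \<le> F * G"
  proof (cases "F = 0")
    case True
    have "P = 0"
    proof (rule ccontr)
      assume "P \<noteq> 0"
      \<comment> \<open>This \<open>s\<close> makes the polynomial, linear when
        \<open>F = 0\<close>, equal to \<open>-1\<close>.\<close>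
      then show False using quad [of "(G + 1) / (2 * P)"] True by simp
    qed
    then show ?thesis using True by simp
  next
    case False
    \<comment> \<open>\<open>P / F\<close> minimises the quadratic, whose value there is
      \<open>G - P\<^sup>2 / F\<close>.\<close>
    then show ?thesis using quad [of "P / F"] \<open>0 \<le> F\<close> by (simp add: power2_eq_square field_simps)
  qed
  then show "(\<integral>x. f x * g x \<partial>M)\<^sup>2 \<le> (\<integral>x. (f x)\<^sup>2 \<partial>M) * (\<integral>x. (g x)\<^sup>2 \<partial>M)"
    by (simp add: F_def G_def P_def)
qed

section \<open>Sine waves as smooth bounded test functions\<close>

text \<open>Cosine is sine with its phase advanced by \<open>pi / 2\<close>, so sine waves with
  arbitrary amplitude and phase are stable under directional derivatives. Mere existence of
  \<open>K\<close> and \<open>b\<close> suffices for differentiability and boundedness at every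
  order.\<close>

lemma dderiv_sin:
  fixes e :: "'a::euclidean_space" and c :: real
  shows "\<exists>K b. dderiv vs (\<lambda>x. sin ((x \<bullet> e) * c)) = (\<lambda>x. K * sin ((x \<bullet> e) * c + b))"
proof (induction vs)
  case Nil
  show ?case by (rule exI [of _ 1], rule exI [of _ 0]) simp
next
  case (Cons v vs)
  then obtain K b where Kb: "dderiv vs (\<lambda>x. sin ((x \<bullet> e) * c)) = (\<lambda>x. K * sin ((x \<bullet> e) * c + b))"
    by blast
  have "((\<lambda>x. K * sin ((x \<bullet> e) * c + b)) has_derivative (\<lambda>v. K * (v \<bullet> e * c) * cos ((x \<bullet> e) * c + b))) (at x)" for x
    by (auto intro!: derivative_eq_intros)
  then have "dderiv (v # vs) (\<lambda>x. sin ((x \<bullet> e) * c)) = (\<lambda>x. K * (v \<bullet> e * c) * cos ((x \<bullet> e) * c + b))"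
    by (simp add: Kb fun_eq_iff) (metis frechet_derivative_at)
  also have "\<dots> = (\<lambda>x. K * (v \<bullet> e * c) * sin ((x \<bullet> e) * c + (b + pi / 2)))"
    by (simp add: sin_add cos_add)
  finally show ?case by blast
qed

lemma Cb_inf_sin:
  fixes e :: "'a::euclidean_space" and c :: real
  shows "Cb_inf (\<lambda>x. sin ((x \<bullet> e) * c))"
  unfolding Cb_inf_def
proof (intro allI impI)
  fix vs :: "'a list"
  obtain K b where "dderiv vs (\<lambda>x. sin ((x \<bullet> e) * c)) = (\<lambda>x. K * sin ((x \<bullet> e) * c + b))"
    using dderiv_sin by blast
  moreover have "(\<lambda>x. K * sin ((x \<bullet> e) * c + b)) differentiable at x" for x
    by (auto intro!: derivative_eq_intros exI simp: differentiable_def)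
  moreover have "bounded (range (\<lambda>x. K * sin ((x \<bullet> e) * c + b)))"
    by (intro boundedI [where B = "\<bar>K\<bar>"]) (auto simp: abs_mult mult_left_le)
  ultimately show "(\<forall>x. dderiv vs (\<lambda>x. sin ((x \<bullet> e) * c)) differentiable at x)
      \<and> bounded (range (dderiv vs (\<lambda>x. sin ((x \<bullet> e) * c))))"
    by simp
qed

section \<open>The probability measure, decay of its density, and the weight\<close>

lemma ZV_pos:
  fixes V :: "'a::euclidean_space \<Rightarrow> real"
  assumes V: "V \<in> borel_measurable borel" "integrable lborel (\<lambda>x. exp (- V x))"
  shows "0 < ZV V"
proof -
  have "0 \<le> ZV V" by (simp add: ZV_def)
  moreover have "ZV V \<noteq> 0"
  proof
    assume "ZV V = 0"
    then have "AE x in (lborel :: 'a measure). exp (- V x) = 0"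
      unfolding ZV_def by (subst (asm) integral_nonneg_eq_0_iff_AE) (use V in auto)
    \<comment> \<open>As the exponential never vanishes, the whole space would be a Lebesgue null
      set.\<close>
    then have "AE x in (lborel :: 'a measure). False" by simp
    then show False by (simp add: AE_iff_null null_sets_def)
  qed
  ultimately show ?thesis by simp
qed

lemma emeasure_muV_UNIV:
  fixes V :: "'a::euclidean_space \<Rightarrow> real"
  assumes [measurable]: "V \<in> borel_measurable borel" and int: "integrable lborel (\<lambda>x. exp (- V x))"
  shows "emeasure (muV V) UNIV = 1"
proof -
  have Z: "0 < ZV V" by (rule ZV_pos) fact+
  have "emeasure (muV V) UNIV = (\<integral>\<^sup>+ x. ennreal (exp (- V x) / ZV V) \<partial>lborel)"
    by (simp add: muV_def emeasure_density)
  also have "\<dots> = ennreal (\<integral>x. exp (- V x) / ZV V \<partial>lborel)"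
    using Z int by (intro nn_integral_eq_integral) auto
  also have "(\<integral>x. exp (- V x) / ZV V \<partial>lborel) = 1"
    using Z by (simp add: ZV_def)
  finally show ?thesis by simp
qed

lemma space_muV [simp]: "space (muV V) = UNIV"
  by (simp add: muV_def)

lemma sets_muV [measurable_cong, simp]: "sets (muV V) = sets borel"
  by (simp add: muV_def)

lemma finite_measure_muV:
  fixes V :: "'a::euclidean_space \<Rightarrow> real"
  assumes "V \<in> borel_measurable borel" "integrable lborel (\<lambda>x. exp (- V x))"
  shows "finite_measure (muV V)"
  by (rule finite_measureI) (simp add: emeasure_muV_UNIV assms)

lemma nn_integral_muV:
  assumes [measurable]: "V \<in> borel_measurable borel" "g \<in> borel_measurable borel"
  shows "(\<integral>\<^sup>+ x. g x \<partial>muV V) = (\<integral>\<^sup>+ x. ennreal (exp (- V x) / ZV V) * g x \<partial>lborel)"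
  unfolding muV_def by (intro nn_integral_density) auto

lemma Cb_inf_measurable:
  assumes "Cb_inf f" shows "f \<in> borel_measurable borel"
proof -
  have "f differentiable at x" for x
    using assms [unfolded Cb_inf_def, rule_format, of "[]"] by simp
  then show ?thesis
    by (intro borel_measurable_continuous_onI)
      (simp add: continuous_on_eq_continuous_at differentiable_imp_continuous_within)
qed

lemma Cb_inf_bounded:
  assumes "Cb_inf f" shows "bounded (range f)"
  using assms [unfolded Cb_inf_def, rule_format, of "[]"] by simp

text \<open>Turns the asymptotic condition into a bound on the whole space: far out the expression
  under the \<open>Limsup\<close> is below 1, and on the remaining ball \<open>exp (- V x)\<close>
  is bounded.\<close>

lemma weight_pointwise_bound:
  fixes V :: "'a::euclidean_space \<Rightarrow> real"
  assumes expV_bdd: "bounded (range (\<lambda>x. exp (- V x)))" and s: "0 < s"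
    and tail: "Limsup at_infinity
       (\<lambda>x::'a. ereal ((SUP z\<in>{z. norm z \<ge> norm x}. exp (- V z)) * norm x powr s)) = 0"
  shows "\<exists>M>0. \<forall>x. exp (- V x) \<le> M * (1 + norm x) powr (- s)"
proof -
  obtain B where B: "\<And>x. exp (- V x) \<le> B"
    using expV_bdd by (auto simp: bounded_iff)
  have "0 < exp (- V 0)" by simp
  then have B_pos: "0 < B" using B [of 0] by linarith
  have "eventually (\<lambda>x::'a. ereal ((SUP z\<in>{z. norm z \<ge> norm x}. exp (- V z)) * norm x powr s) < 1) at_infinity"
    by (rule Limsup_lessD) (simp add: tail)
  then obtain b where b: "\<And>x::'a. b \<le> norm x \<Longrightarrow> (SUP z\<in>{z. norm z \<ge> norm x}. exp (- V z)) * norm x powr s < 1"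
    by (auto simp: eventually_at_infinity one_ereal_def)
  \<comment> \<open>Taking \<open>b'\<close> at least 1 ensures
    \<open>1 + norm x \<le> 2 * norm x\<close> beyond it, whence the entry \<open>2 powr s\<close>
    of \<open>M\<close>; the other entry serves the ball of radius \<open>b'\<close>.\<close>
  define b' where "b' = max b 1"
  define M where "M = max (B * (1 + b') powr s) (2 powr s)"
  have "exp (- V x) \<le> M * (1 + norm x) powr (- s)" for x
  proof -
    have "exp (- V x) * (1 + norm x) powr s \<le> M"
    proof (cases "norm x \<le> b'")
      case True
      have "exp (- V x) * (1 + norm x) powr s \<le> B * (1 + b') powr s"
        using True B_pos s by (intro mult_mono B powr_mono2) auto
      then show ?thesis by (simp add: M_def)
    next
      case False
      then have x: "b \<le> norm x" "1 \<le> norm x" by (auto simp: b'_def)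
      \<comment> \<open>A real supremum dominates its members only for a set bounded above, which
        \<open>B\<close> guarantees.\<close>
      have "exp (- V x) \<le> (SUP z\<in>{z. norm z \<ge> norm x}. exp (- V z))"
        by (intro cSUP_upper) (auto intro!: bdd_aboveI2 [where M = B] B)
      then have "exp (- V x) * norm x powr s \<le> (SUP z\<in>{z. norm z \<ge> norm x}. exp (- V z)) * norm x powr s"
        by (intro mult_right_mono) auto
      then have le1: "exp (- V x) * norm x powr s \<le> 1" using b [OF x(1)] by linarith
      have "exp (- V x) * (1 + norm x) powr s \<le> exp (- V x) * (2 * norm x) powr s"
        using x s by (intro mult_left_mono powr_mono2) auto
      also have "\<dots> = 2 powr s * (exp (- V x) * norm x powr s)"
        using x by (simp add: powr_mult)
      also have "\<dots> \<le> 2 powr s * 1" by (intro mult_left_mono le1) auto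
      finally show ?thesis by (simp add: M_def)
    qed
    moreover have "0 < (1 + norm x) powr s"
      by (metis add_pos_nonneg less_numeral_extra(1,3) norm_ge_zero powr_gt_zero)
    ultimately show ?thesis by (simp add: powr_minus divide_simps)
  qed
  moreover have "0 < M" using B_pos by (simp add: M_def less_max_iff_disj)
  ultimately show ?thesis by blast
qed

text \<open>The factor \<open>exp (V x)\<close> of \<open>omega\<close> cancels the density of
  \<open>muV V\<close>, so integrals against the weight become Lebesgue integrals in which
  \<open>V\<close> survives only through \<open>ZV V\<close>.\<close>

lemma nn_integral_omega_muV:
  fixes V :: "'a::euclidean_space \<Rightarrow> real"
  assumes [measurable]: "V \<in> borel_measurable borel" "h \<in> borel_measurable borel"
    and int: "integrable lborel (\<lambda>x. exp (- V x))" and h: "\<And>x. 0 \<le> h x"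
  shows "(\<integral>\<^sup>+ x. ennreal (h x * omega \<alpha> V x) \<partial>muV V)
    = (\<integral>\<^sup>+ x. ennreal (h x * (1 + norm x) powr (- (real DIM('a) + \<alpha>)) / ZV V) \<partial>lborel)"
proof -
  have Z: "0 < ZV V" by (rule ZV_pos) fact+
  have [measurable]: "omega \<alpha> V \<in> borel_measurable borel"
    unfolding omega_def [abs_def] by measurable
  have "(\<integral>\<^sup>+ x. ennreal (h x * omega \<alpha> V x) \<partial>muV V)
    = (\<integral>\<^sup>+ x. ennreal (exp (- V x) / ZV V) * ennreal (h x * omega \<alpha> V x) \<partial>lborel)"
    by (intro nn_integral_muV) auto
  also have "\<dots> = (\<integral>\<^sup>+ x. ennreal (h x * (1 + norm x) powr (- (real DIM('a) + \<alpha>)) / ZV V) \<partial>lborel)"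
  proof (intro nn_integral_cong)
    fix x :: 'a
    have eq: "exp (- V x) / ZV V * (h x * omega \<alpha> V x) = h x * (1 + norm x) powr (- (real DIM('a) + \<alpha>)) / ZV V"
      unfolding omega_def by (simp only: powr_minus exp_minus) (simp add: field_simps)
    have "0 \<le> exp (- V x) / ZV V" using Z by simp
    then show "ennreal (exp (- V x) / ZV V) * ennreal (h x * omega \<alpha> V x)
      = ennreal (h x * (1 + norm x) powr (- (real DIM('a) + \<alpha>)) / ZV V)"
      by (simp only: ennreal_mult' [symmetric] eq)
  qed
  finally show ?thesis .
qed

section \<open>The weighted Poincare inequality\<close>

lemma integrable_square_diff_mult:
  fixes f q :: "'a \<Rightarrow> real"
  assumes [measurable]: "f \<in> borel_measurable M" "q \<in> borel_measurable M"
    and f_bdd: "bounded (range f)" and q_nonneg: "\<And>x. 0 \<le> q x" and q_int: "integrable M q"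
  shows "integrable M (\<lambda>x. (f x - c)\<^sup>2 * q x)"
proof -
  obtain B where B: "\<And>x. \<bar>f x\<bar> \<le> B" using f_bdd by (auto simp: bounded_iff)
  show ?thesis
  proof (rule Bochner_Integration.integrable_bound [where f = "\<lambda>x. (B + \<bar>c\<bar>)\<^sup>2 * q x"])
    show "AE x in M. norm ((f x - c)\<^sup>2 * q x) \<le> norm ((B + \<bar>c\<bar>)\<^sup>2 * q x)"
    proof (intro AE_I2)
      fix x
      have "\<bar>f x - c\<bar> \<le> \<bar>B + \<bar>c\<bar>\<bar>" using B [of x] by linarith
      then have "(f x - c)\<^sup>2 \<le> (B + \<bar>c\<bar>)\<^sup>2" by (simp only: abs_le_square_iff)
      then show "norm ((f x - c)\<^sup>2 * q x) \<le> norm ((B + \<bar>c\<bar>)\<^sup>2 * q x)"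
        using q_nonneg [of x] by (simp add: abs_mult mult_right_mono)
    qed
  qed (use q_int in auto)
qed

text \<open>Both terms of \<open>f x - \<mu> = (f x - f y) + (f y - \<mu>)\<close> are controlled by the increments from the
  single point \<open>y\<close>: the second one is the \<open>\<mu>\<close>-average of \<open>f y - f x\<close>, and Cauchy--Schwarz applies to
  \<open>w / sqrt q\<close> and \<open>(f y - f x) * sqrt q\<close>.\<close>
lemma centred_le_increments:
  fixes V :: "'a::euclidean_space \<Rightarrow> real" and q f :: "'a \<Rightarrow> real"
  assumes V [measurable]: "V \<in> borel_measurable borel" and int: "integrable lborel (\<lambda>x. exp (- V x))"
    and f [measurable]: "f \<in> borel_measurable borel" and f_bdd: "bounded (range f)"
    and q [measurable]: "q \<in> borel_measurable borel" and q_pos: "\<And>x. 0 < q x" and q_int: "integrable lborel q"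
    and A_int: "integrable lborel (\<lambda>x. (exp (- V x) / ZV V)\<^sup>2 / q x)"
  shows "(\<integral>x. (f x - muV_f V f)\<^sup>2 * q x \<partial>lborel)
    \<le> (2 + 2 * (\<integral>x. (exp (- V x) / ZV V)\<^sup>2 / q x \<partial>lborel) * (\<integral>x. q x \<partial>lborel))
      * (\<integral>x. (f x - f y)\<^sup>2 * q x \<partial>lborel)"
proof -
  define w where "w = (\<lambda>x. exp (- V x) / ZV V)"
  have Z: "0 < ZV V" by (rule ZV_pos) fact+
  have w_int: "integrable lborel w" and w1: "(\<integral>x. w x \<partial>lborel) = 1"
    using int Z by (simp_all add: w_def ZV_def)
  have w_nonneg: "0 \<le> w x" for x using Z by (simp add: w_def)
  have [measurable]: "w \<in> borel_measurable borel" by (simp add: w_def)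
  define A S G \<mu> where "A = (\<integral>x. (w x)\<^sup>2 / q x \<partial>lborel)" and "S = (\<integral>x. q x \<partial>lborel)"
    and "G = (\<integral>x. (f x - f y)\<^sup>2 * q x \<partial>lborel)" and "\<mu> = muV_f V f"
  obtain B where B: "\<And>x. \<bar>f x\<bar> \<le> B" using f_bdd by (auto simp: bounded_iff)
  have sq_int: "integrable lborel (\<lambda>x. (f x - c)\<^sup>2 * q x)" for c
    by (rule integrable_square_diff_mult) (use f_bdd q_int q_pos in \<open>auto simp: less_imp_le\<close>)
  have fw_int: "integrable lborel (\<lambda>x. w x * f x)"
  proof (rule Bochner_Integration.integrable_bound [where f = "\<lambda>x. B * w x"])
    show "AE x in lborel. norm (w x * f x) \<le> norm (B * w x)"
    proof (intro AE_I2)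
      fix x
      have "\<bar>f x\<bar> \<le> \<bar>B\<bar>" using B [of x] by linarith
      then show "norm (w x * f x) \<le> norm (B * w x)"
        using w_nonneg [of x] by (simp add: abs_mult mult_left_mono mult.commute [of _ "w x"])
    qed
  qed (use w_int in auto)
  have \<mu>: "\<mu> = (\<integral>x. w x * f x \<partial>lborel)"
    unfolding \<mu>_def muV_f_def muV_def w_def
    using Z by (subst integral_density) auto
  have "\<mu> - f y = (\<integral>x. w x * f x \<partial>lborel) - (\<integral>x. w x * f y \<partial>lborel)"
    by (simp add: \<mu> w1)
  also have "\<dots> = (\<integral>x. w x * f x - w x * f y \<partial>lborel)"
    using fw_int w_int by (intro Bochner_Integration.integral_diff [symmetric]) auto
  also have "\<dots> = (\<integral>x. (w x / sqrt (q x)) * ((f x - f y) * sqrt (q x)) \<partial>lborel)"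
    using q_pos by (intro Bochner_Integration.integral_cong) (auto simp: algebra_simps less_imp_neq [symmetric])
  also have "\<dots>\<^sup>2 \<le> (\<integral>x. (w x / sqrt (q x))\<^sup>2 \<partial>lborel) * (\<integral>x. ((f x - f y) * sqrt (q x))\<^sup>2 \<partial>lborel)"
    using q_pos A_int sq_int
    by (intro integral_Cauchy_Schwarz) (auto simp: power_divide power_mult_distrib less_imp_le w_def)
  also have "\<dots> = A * G"
    using q_pos by (simp add: power_divide power_mult_distrib less_imp_le A_def G_def)
  finally have CS: "(f y - \<mu>)\<^sup>2 \<le> A * G" by (simp add: power2_commute)
  \<comment> \<open>The inequality
    \<open>(s + t)\<^sup>2 \<le> 2 * s\<^sup>2 + 2 * t\<^sup>2\<close> produces both factors 2 of
    the constant; \<open>A\<close> then enters through \<open>CS\<close>, and \<open>S\<close>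
    through integrating \<open>q\<close> against a constant.\<close>
  have "(\<integral>x. (f x - \<mu>)\<^sup>2 * q x \<partial>lborel) \<le> (\<integral>x. 2 * ((f x - f y)\<^sup>2 * q x) + 2 * (f y - \<mu>)\<^sup>2 * q x \<partial>lborel)"
  proof (intro integral_mono)
    fix x
    have "(f x - \<mu>)\<^sup>2 \<le> 2 * (f x - f y)\<^sup>2 + 2 * (f y - \<mu>)\<^sup>2"
      using sum_squares_bound [of "f x - f y" "f y - \<mu>"] by (simp add: power2_eq_square algebra_simps)
    then have "(f x - \<mu>)\<^sup>2 * q x \<le> (2 * (f x - f y)\<^sup>2 + 2 * (f y - \<mu>)\<^sup>2) * q x"
      using q_pos [of x] by (intro mult_right_mono) auto
    then show "(f x - \<mu>)\<^sup>2 * q x \<le> 2 * ((f x - f y)\<^sup>2 * q x) + 2 * (f y - \<mu>)\<^sup>2 * q x"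
      by (simp add: algebra_simps)
  qed (use sq_int q_int in auto)
  also have "\<dots> = 2 * G + 2 * (f y - \<mu>)\<^sup>2 * S"
    using sq_int q_int by (simp add: G_def S_def)
  also have "\<dots> \<le> 2 * G + 2 * (A * G) * S"
  proof -
    have "0 \<le> S" unfolding S_def using q_pos by (simp add: less_imp_le)
    then show ?thesis using CS by (intro add_left_mono mult_right_mono) auto
  qed
  finally show ?thesis by (simp add: A_def S_def G_def \<mu>_def w_def algebra_simps)
qed

text \<open>\<open>centred_le_increments\<close> is available at every base point. Base points in
  the unit ball are averaged, which bounds the weighted variance by the part of the energy with its
  outer variable in that ball.\<close>

lemma weighted_Poincare:
  fixes V :: "'a::euclidean_space \<Rightarrow> real" and \<alpha> \<alpha>0 :: real
  assumes V [measurable]: "V \<in> borel_measurable borel"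
    and int: "integrable lborel (\<lambda>x. exp (- V x))"
    and \<alpha>: "0 < \<alpha>" "\<alpha>0 < \<alpha> / 2"
    and M: "\<And>x. exp (- V x) \<le> M * (1 + norm x) powr (- (real DIM('a) + \<alpha> - \<alpha>0))"
  shows "\<exists>C>0. \<forall>f. f \<in> borel_measurable borel \<longrightarrow> bounded (range f) \<longrightarrow>
    (\<integral>\<^sup>+ x. ennreal ((f x - muV_f V f)\<^sup>2 * omega \<alpha> V x) \<partial>muV V) \<le> ennreal C * D_form \<alpha> V f"
proof -
  define p where "p = real DIM('a) + \<alpha>"
  have p: "0 < p" using \<alpha> by (simp add: p_def add_nonneg_pos)
  define q :: "'a \<Rightarrow> real" where "q = (\<lambda>x. (1 + norm x) powr (- p))"
  define A S where "A = (\<integral>x. (exp (- V x) / ZV V)\<^sup>2 / q x \<partial>lborel)" and "S = (\<integral>x. q x \<partial>lborel)"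
  define c where "c = 2 + 2 * A * S"
  define b where "b = measure (muV V) (cball 0 1)"
  have Z: "0 < ZV V" by (rule ZV_pos) fact+
  have one_norm: "0 < 1 + norm x" for x :: 'a by (simp add: add_pos_nonneg)
  have q_pos: "0 < q x" for x by (metis one_norm powr_gt_zero q_def less_numeral_extra(3))
  have q_int: "integrable lborel q"
    unfolding q_def p_def by (rule integrable_one_plus_norm_powr) fact
  have [measurable]: "q \<in> borel_measurable borel" by (simp add: q_def)
  have A_int: "integrable lborel (\<lambda>x. (exp (- V x) / ZV V)\<^sup>2 / q x)"
  proof (rule Bochner_Integration.integrable_bound)
    \<comment> \<open>Squaring the bound \<open>M\<close> and dividing by \<open>q\<close> gives the
      exponent \<open>- 2 * (p - \<alpha>0) + p = - (p - 2 * \<alpha>0)\<close>. It still exceeds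
      the dimension in absolute value because \<open>2 * \<alpha>0 < \<alpha>\<close>.\<close>
    show "integrable lborel (\<lambda>x::'a. (M / ZV V)\<^sup>2 * (1 + norm x) powr (- (real DIM('a) + (\<alpha> - 2 * \<alpha>0))))"
      using \<alpha> by (intro integrable_mult_right integrable_one_plus_norm_powr) auto
    show "AE x in lborel. norm ((exp (- V x) / ZV V)\<^sup>2 / q x)
      \<le> norm ((M / ZV V)\<^sup>2 * (1 + norm x) powr (- (real DIM('a) + (\<alpha> - 2 * \<alpha>0))))"
    proof (intro AE_I2)
      fix x :: 'a
      have "(exp (- V x))\<^sup>2 \<le> (M * (1 + norm x) powr (- (p - \<alpha>0)))\<^sup>2"
        using M [of x] by (intro power_mono) (auto simp: p_def)
      also have "\<dots> = M\<^sup>2 * (1 + norm x) powr (- (2 * (p - \<alpha>0)))"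
        using one_norm [of x] by (simp add: power_mult_distrib powr_power algebra_simps)
      finally have "(exp (- V x))\<^sup>2 / q x \<le> M\<^sup>2 * (1 + norm x) powr (- (2 * (p - \<alpha>0))) / q x"
        using q_pos [of x] by (intro divide_right_mono) auto
      also have "\<dots> = M\<^sup>2 * ((1 + norm x) powr (- (2 * (p - \<alpha>0))) * (1 + norm x) powr p)"
        by (simp add: q_def powr_minus [of _ p] divide_inverse)
      also have "(1 + norm x) powr (- (2 * (p - \<alpha>0))) * (1 + norm x) powr p
        = (1 + norm x) powr (- (real DIM('a) + (\<alpha> - 2 * \<alpha>0)))"
        by (simp add: powr_add [symmetric] p_def)
      finally have "(exp (- V x))\<^sup>2 / q x / (ZV V)\<^sup>2
        \<le> M\<^sup>2 * (1 + norm x) powr (- (real DIM('a) + (\<alpha> - 2 * \<alpha>0))) / (ZV V)\<^sup>2"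
        by (intro divide_right_mono) auto
      then show "norm ((exp (- V x) / ZV V)\<^sup>2 / q x)
        \<le> norm ((M / ZV V)\<^sup>2 * (1 + norm x) powr (- (real DIM('a) + (\<alpha> - 2 * \<alpha>0))))"
        using q_pos [of x] by (simp add: power_divide mult.commute)
    qed
  qed measurable
  have "0 \<le> A" "0 \<le> S"
    using q_pos by (auto simp: A_def S_def less_imp_le)
  then have c: "0 < c" by (simp add: c_def add_pos_nonneg)
  interpret finite_measure "muV V" by (rule finite_measure_muV) fact+
  have b: "0 < b"
  proof -
    have "emeasure (muV V) (cball 0 1) \<noteq> 0"
    proof
      have [measurable]: "cball (0::'a) 1 \<in> sets borel" by simp
      assume "emeasure (muV V) (cball 0 1) = 0"
      then have "(\<integral>\<^sup>+ x. ennreal (exp (- V x) / ZV V) * indicator (cball 0 1) x \<partial>lborel) = 0"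
        by (simp add: muV_def emeasure_density)
      then have "AE x in lborel. ennreal (exp (- V x) / ZV V) * indicator (cball 0 1) x = 0"
        by (subst (asm) nn_integral_0_iff_AE) auto
      \<comment> \<open>The density is positive everywhere, so a ball of
        \<open>muV V\<close>-measure zero would be Lebesgue null.\<close>
      then have "AE x in lborel. x \<notin> cball (0::'a) 1"
        by eventually_elim (use Z in \<open>auto simp: indicator_def divide_le_0_iff split: if_splits\<close>)
      then have "emeasure lborel (cball (0::'a) 1) = 0"
        by (simp add: AE_iff_null null_sets_def mem_cball cball_def)
      then show False
        by (auto simp: emeasure_cball ennreal_eq_0_iff dest: leD)
    qed
    then show ?thesis by (simp add: b_def emeasure_eq_measure less_le)
  qed
  \<comment> \<open>\<open>c\<close> is the constant of \<open>centred_le_increments\<close>,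
    \<open>b\<close> the mass of the averaging ball, and \<open>ZV V\<close> relates
    \<open>H\<close> to the weighted variance.\<close>
  define C where "C = c / (b * ZV V)"
  have C: "0 < C" using b c Z by (simp add: C_def)
  have "(\<integral>\<^sup>+ x. ennreal ((f x - muV_f V f)\<^sup>2 * omega \<alpha> V x) \<partial>muV V) \<le> ennreal C * D_form \<alpha> V f"
    if f [measurable]: "f \<in> borel_measurable borel" and f_bdd: "bounded (range f)" for f
  proof -
    define H where "H = (\<integral>x. (f x - muV_f V f)\<^sup>2 * q x \<partial>lborel)"
    have H_nonneg: "0 \<le> H" using q_pos by (simp add: H_def less_imp_le)
    obtain B where B: "\<And>x. \<bar>f x\<bar> \<le> B" using f_bdd by (auto simp: bounded_iff)
    have sq_int: "integrable lborel (\<lambda>x. (f x - a)\<^sup>2 * q x)" for a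
      by (rule integrable_square_diff_mult) (use f_bdd q_int q_pos in \<open>auto simp: less_imp_le\<close>)
    \<comment> \<open>The lower bound \<open>H / c\<close> does not depend on \<open>x\<close>, so
      integrating it over the unit ball multiplies it by \<open>b\<close>.\<close>
    have inner: "ennreal (H / c) \<le> (\<integral>\<^sup>+ y. ennreal ((f y - f x)\<^sup>2 / norm (y - x) powr p) \<partial>lborel)"
      if x: "norm x \<le> 1" for x
    proof -
      have "H \<le> c * (\<integral>y. (f y - f x)\<^sup>2 * q y \<partial>lborel)"
        unfolding H_def c_def A_def S_def
        by (rule centred_le_increments) (use int f_bdd q_pos q_int A_int in auto)
      then have "H / c \<le> (\<integral>y. (f y - f x)\<^sup>2 * q y \<partial>lborel)"
        using c by (simp add: divide_simps mult.commute)
      then have "ennreal (H / c) \<le> (\<integral>\<^sup>+ y. ennreal ((f y - f x)\<^sup>2 * q y) \<partial>lborel)"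
        using sq_int q_pos by (subst nn_integral_eq_integral) (auto simp: less_imp_le intro!: ennreal_leI)
      also have "\<dots> \<le> (\<integral>\<^sup>+ y. ennreal ((f y - f x)\<^sup>2 / norm (y - x) powr p) \<partial>lborel)"
      proof (intro nn_integral_mono ennreal_leI)
        fix y
        show "(f y - f x)\<^sup>2 * q y \<le> (f y - f x)\<^sup>2 / norm (y - x) powr p"
        \<comment> \<open>At \<open>y = x\<close> the comparison of \<open>q y\<close> with
          \<open>norm (y - x) powr (- p)\<close> fails, since \<open>0 powr (- p) = 0\<close>; there
          the increment of \<open>f\<close> vanishes instead.\<close>
        proof (cases "y = x")
          case False
          have "norm (y - x) \<le> 1 + norm y" using norm_triangle_ineq4 [of y x] x by linarith
          then have "q y \<le> norm (y - x) powr (- p)"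
            unfolding q_def using False p by (intro powr_mono2') auto
          then have "(f y - f x)\<^sup>2 * q y \<le> (f y - f x)\<^sup>2 * norm (y - x) powr (- p)"
            by (intro mult_left_mono) auto
          then show ?thesis by (simp add: powr_minus divide_inverse)
        qed simp
      qed
      finally show ?thesis .
    qed
    have "ennreal (H / c * b) = (\<integral>\<^sup>+ x. ennreal (H / c) * indicator (cball 0 1) x \<partial>muV V)"
      using H_nonneg c by (simp add: nn_integral_cmult_indicator b_def emeasure_eq_measure ennreal_mult''
          del: times_divide_eq_left)
    also have "\<dots> \<le> D_form \<alpha> V f"
      unfolding D_form_def p_def [symmetric]
      by (intro nn_integral_mono) (auto simp: indicator_def inner)
    finally have D: "ennreal (H / c * b) \<le> D_form \<alpha> V f" .
    have "(\<integral>\<^sup>+ x. ennreal ((f x - muV_f V f)\<^sup>2 * omega \<alpha> V x) \<partial>muV V)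
      = (\<integral>\<^sup>+ x. ennreal ((f x - muV_f V f)\<^sup>2 * (1 + norm x) powr (- (real DIM('a) + \<alpha>)) / ZV V) \<partial>lborel)"
      by (intro nn_integral_omega_muV int) auto
    also have "\<dots> = (\<integral>\<^sup>+ x. ennreal ((f x - muV_f V f)\<^sup>2 * q x / ZV V) \<partial>lborel)"
      by (simp add: q_def p_def)
    also have "\<dots> = ennreal (H / ZV V)"
      using sq_int Z q_pos by (subst nn_integral_eq_integral) (auto simp: H_def less_imp_le)
    also have "H / ZV V = C * (H / c * b)"
      using b c Z by (simp add: C_def)
    also have "ennreal \<dots> = ennreal C * ennreal (H / c * b)"
      using C by (simp add: ennreal_mult' less_imp_le del: times_divide_eq_left times_divide_eq_right)
    also have "\<dots> \<le> ennreal C * D_form \<alpha> V f"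
      by (intro mult_left_mono D) auto
    finally show ?thesis .
  qed
  with C show ?thesis by blast
qed

section \<open>Optimality of the weight\<close>

lemma abs_sin_diff_le: "\<bar>sin a - sin b\<bar> \<le> \<bar>a - b\<bar>" for a b :: real
proof -
  have "\<bar>sin a - sin b\<bar> = 2 * (\<bar>sin ((a - b) / 2)\<bar> * \<bar>cos ((a + b) / 2)\<bar>)"
    by (simp add: sin_diff_sin abs_mult)
  also have "\<dots> \<le> 2 * (\<bar>(a - b) / 2\<bar> * 1)"
    by (intro mult_left_mono mult_mono abs_sin_x_le_abs_x abs_cos_le_one) auto
  finally show ?thesis by simp
qed

text \<open>The inner integral is bounded uniformly in \<open>x\<close> by a radial integral of
  order \<open>R powr (- \<alpha>)\<close>, and the outer integration is against a probability
  measure. It matters that \<open>K\<close> is independent of \<open>R\<close>.\<close>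

lemma D_form_sin_le:
  fixes V :: "'a::euclidean_space \<Rightarrow> real" and e :: 'a
  assumes V [measurable]: "V \<in> borel_measurable borel"
    and int: "integrable lborel (\<lambda>x. exp (- V x))"
    and \<alpha>: "0 < \<alpha>" "\<alpha> < 2" and e: "norm e = 1"
  shows "\<exists>K>0. \<forall>R>0. D_form \<alpha> V (\<lambda>x. sin ((x \<bullet> e) * (1 / R))) \<le> ennreal (K * R powr (- \<alpha>))"
proof -
  define p where "p = real DIM('a) + \<alpha>"
  define K0 where "K0 = 2 powr (p + 1) * unit_ball_vol (real DIM('a))"
  define K where "K = K0 * (1 / (2 - \<alpha>) + 4 / \<alpha>)"
  have K0: "0 < K0" by (simp add: K0_def)
  then have K: "0 < K" using \<alpha> by (simp add: K_def add_pos_pos)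
  have "D_form \<alpha> V (\<lambda>x. sin ((x \<bullet> e) * (1 / R))) \<le> ennreal (K * R powr (- \<alpha>))" if R: "0 < R" for R
  proof -
    \<comment> \<open>The square comes from the Lipschitz constant \<open>1 / R\<close> of the wave,
      the 4 from its oscillation being at most 2.\<close>
    define m where "m = (\<lambda>t. min ((t / R)\<^sup>2) (4::real))"
    have [measurable]: "m \<in> borel_measurable borel" by (simp add: m_def)
    have inner: "(\<integral>\<^sup>+ y. ennreal ((sin ((y \<bullet> e) * (1 / R)) - sin ((x \<bullet> e) * (1 / R)))\<^sup>2 / norm (y - x) powr p) \<partial>lborel)
      \<le> ennreal (K * R powr (- \<alpha>))" (is "?I \<le> _") for x :: 'a
    proof -
      have "?I \<le> (\<integral>\<^sup>+ y. ennreal (m (norm (y - x)) / norm (y - x) powr p) \<partial>lborel)"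
      proof (intro nn_integral_mono ennreal_leI divide_right_mono)
        fix y :: 'a
        let ?d = "sin ((y \<bullet> e) * (1 / R)) - sin ((x \<bullet> e) * (1 / R))"
        have "\<bar>?d\<bar> \<le> \<bar>(y \<bullet> e) * (1 / R) - (x \<bullet> e) * (1 / R)\<bar>"
          by (rule abs_sin_diff_le)
        also have "\<dots> = \<bar>(y - x) \<bullet> e\<bar> / R"
          using R by (simp add: inner_diff_left diff_divide_distrib [symmetric])
        also have "\<dots> \<le> norm (y - x) / R"
          using Cauchy_Schwarz_ineq2 [of "y - x" e] e R by (simp add: divide_right_mono)
        finally have "?d\<^sup>2 \<le> (norm (y - x) / R)\<^sup>2"
          using R by (simp add: abs_le_square_iff [symmetric])
        moreover have "\<bar>?d\<bar> \<le> 2"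
          using sin_le_one [of "(y \<bullet> e) * (1 / R)"] sin_le_one [of "(x \<bullet> e) * (1 / R)"]
            sin_ge_minus_one [of "(y \<bullet> e) * (1 / R)"] sin_ge_minus_one [of "(x \<bullet> e) * (1 / R)"]
          by linarith
        then have "?d\<^sup>2 \<le> 4" using abs_le_square_iff [of ?d 2] by simp
        ultimately show "?d\<^sup>2 \<le> m (norm (y - x))" by (simp add: m_def)
      qed simp
      \<comment> \<open>Translation invariance of Lebesgue measure: substituting
        \<open>y = x + z\<close> moves the singularity to the origin.\<close>
      also have "\<dots> = (\<integral>\<^sup>+ y. ennreal (m (norm (y - x)) / norm (y - x) powr p) \<partial>distr lborel borel ((+) x))"
        by (simp add: lborel_distr_plus)
      also have "\<dots> = (\<integral>\<^sup>+ z. ennreal (m (norm z) / norm z powr p) \<partial>(lborel :: 'a measure))"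
        by (subst nn_integral_distr) auto
      also have "\<dots> \<le> ennreal K0 * (\<integral>\<^sup>+ t. ennreal (m t * t powr (- \<alpha> - 1)) * indicator {0<..} t \<partial>lborel)"
        unfolding K0_def p_def
      proof (rule nn_integral_radial_le)
        fix s t :: real assume "0 < s" "s \<le> t"
        then have "(s / R)\<^sup>2 \<le> (t / R)\<^sup>2" using R by (intro power_mono divide_right_mono) auto
        then show "m s \<le> m t" by (auto simp: m_def)
      qed (use \<alpha> in \<open>auto simp: m_def\<close>)
      also have "\<dots> \<le> ennreal K0 * ennreal ((1 / (2 - \<alpha>) + 4 / \<alpha>) * R powr (- \<alpha>))"
        unfolding m_def using \<alpha> R by (intro mult_left_mono nn_integral_min_square_powr_le) auto
      also have "\<dots> = ennreal (K * R powr (- \<alpha>))"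
        using K0 by (subst ennreal_mult' [symmetric]) (auto simp: K_def mult.assoc)
      finally show ?thesis .
    qed
    have "D_form \<alpha> V (\<lambda>x. sin ((x \<bullet> e) * (1 / R))) \<le> (\<integral>\<^sup>+ x. ennreal (K * R powr (- \<alpha>)) \<partial>muV V)"
      unfolding D_form_def p_def [symmetric] by (intro nn_integral_mono inner)
    also have "\<dots> = ennreal (K * R powr (- \<alpha>))"
      using emeasure_muV_UNIV [OF V int] by simp
    finally show ?thesis .
  qed
  with K show ?thesis by blast
qed

text \<open>Dominated convergence: the waves tend to \<open>sin 0\<close> pointwise and are bounded
  by 1, which is integrable for a finite measure.\<close>

lemma muV_f_sin_tendsto_0:
  fixes V :: "'a::euclidean_space \<Rightarrow> real" and e :: 'a
  assumes V [measurable]: "V \<in> borel_measurable borel"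
    and int: "integrable lborel (\<lambda>x. exp (- V x))"
  shows "((\<lambda>R. muV_f V (\<lambda>x. sin ((x \<bullet> e) * (1 / R)))) \<longlongrightarrow> 0) at_top"
proof -
  interpret finite_measure "muV V" by (rule finite_measure_muV) fact+
  have "((\<lambda>R. \<integral>x. sin ((x \<bullet> e) * (1 / R)) \<partial>muV V) \<longlongrightarrow> (\<integral>x. 0 \<partial>muV V)) at_top"
  proof (rule integral_dominated_convergence_at_top)
    show "AE x in muV V. ((\<lambda>R. sin ((x \<bullet> e) * (1 / R))) \<longlongrightarrow> 0) at_top"
    proof (intro AE_I2)
      fix x
      have "((\<lambda>R. sin ((x \<bullet> e) * (1 / R))) \<longlongrightarrow> sin ((x \<bullet> e) * 0)) at_top"
        by (intro tendsto_intros tendsto_divide_0 [OF tendsto_const] filterlim_at_top_imp_at_infinity filterlim_ident)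
      then show "((\<lambda>R. sin ((x \<bullet> e) * (1 / R))) \<longlongrightarrow> 0) at_top" by simp
    qed
    show "\<forall>\<^sub>F R in at_top. AE x in muV V. norm (sin ((x \<bullet> e) * (1 / R))) \<le> 1"
      by simp
  qed auto
  then show ?thesis by (simp add: muV_f_def)
qed

text \<open>The bound is uniform in \<open>a\<close> because the mean of the wave is only known to
  be small. The indicator confines the integral to the region where a competing weight can be
  compared with \<open>omega\<close>.\<close>

lemma centred_sin_lower_bound:
  fixes V :: "'a::euclidean_space \<Rightarrow> real" and e :: 'a
  assumes V [measurable]: "V \<in> borel_measurable borel"
    and int: "integrable lborel (\<lambda>x. exp (- V x))"
    and \<alpha>: "0 < \<alpha>" and e: "norm e = 1"
  shows "\<exists>k>0. \<forall>R\<ge>1. \<forall>a. \<bar>a\<bar> \<le> 1 / 4 \<longrightarrow>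
    ennreal (k * R powr (- \<alpha>)) \<le> (\<integral>\<^sup>+ x. ennreal ((sin ((x \<bullet> e) * (1 / R)) - a)\<^sup>2 * indicator {x. R \<le> norm x} x * omega \<alpha> V x) \<partial>muV V)"
proof -
  define n where "n = DIM('a)"
  define p where "p = real n + \<alpha>"
  have p: "0 < p" using \<alpha> by (simp add: p_def add_nonneg_pos)
  have Z: "0 < ZV V" by (rule ZV_pos) fact+
  \<comment> \<open>\<open>3 powr (- p)\<close> bounds the weight, \<open>1 / 16\<close> is the
    square of \<open>1 / 2 - 1 / 4\<close>, and the last factor is the volume of a ball of radius
    \<open>R / 2\<close> without its power of \<open>R\<close>.\<close>
  define k where "k = 3 powr (- p) / 16 / ZV V * (unit_ball_vol (real n) * (1 / 2) ^ n)"
  have k: "0 < k" using Z by (simp add: k_def)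
  have "ennreal (k * R powr (- \<alpha>)) \<le> (\<integral>\<^sup>+ x. ennreal ((sin ((x \<bullet> e) * (1 / R)) - a)\<^sup>2 * indicator {x. R \<le> norm x} x * omega \<alpha> V x) \<partial>muV V)"
    if R: "1 \<le> R" and a: "\<bar>a\<bar> \<le> 1 / 4" for R a
  proof -
    \<comment> \<open>On this ball \<open>norm x\<close> and \<open>x \<bullet> e\<close> both lie
      between \<open>R\<close> and \<open>2 * R\<close>, so the argument of the sine lies in
      \<open>{1..2}\<close>.\<close>
    define B where "B = cball ((3 / 2 * R) *\<^sub>R e) (R / 2)"
    have "k * R powr (- \<alpha>) = (3 * R) powr (- p) / 16 / ZV V * (unit_ball_vol (real n) * (R / 2) ^ n)"
    proof -
      have "R powr (- \<alpha>) = R powr (- p) * R ^ n"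
        using R by (simp add: p_def powr_realpow [symmetric] powr_add [symmetric])
      then show ?thesis
        using R by (simp add: k_def powr_mult power_divide)
    qed
    also have "ennreal \<dots> = ennreal ((3 * R) powr (- p) / 16 / ZV V) * emeasure lborel B"
      using R Z by (simp add: B_def emeasure_cball n_def ennreal_mult' [symmetric] del: times_divide_eq_left times_divide_eq_right)
    also have "\<dots> = (\<integral>\<^sup>+ x. ennreal ((3 * R) powr (- p) / 16 / ZV V) * indicator B x \<partial>lborel)"
      by (simp add: B_def nn_integral_cmult_indicator)
    also have "\<dots> \<le> (\<integral>\<^sup>+ x. ennreal (((sin ((x \<bullet> e) * (1 / R)) - a)\<^sup>2 * indicator {x. R \<le> norm x} x) * (1 + norm x) powr (- (real DIM('a) + \<alpha>)) / ZV V) \<partial>lborel)"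
    proof (intro nn_integral_mono)
      fix x
      show "ennreal ((3 * R) powr (- p) / 16 / ZV V) * indicator B x
        \<le> ennreal (((sin ((x \<bullet> e) * (1 / R)) - a)\<^sup>2 * indicator {x. R \<le> norm x} x) * (1 + norm x) powr (- (real DIM('a) + \<alpha>)) / ZV V)"
      proof (cases "x \<in> B")
        case True
        define u where "u = x - (3 / 2 * R) *\<^sub>R e"
        have x: "x = (3 / 2 * R) *\<^sub>R e + u" by (simp add: u_def)
        have u: "norm u \<le> R / 2" using True by (simp add: B_def u_def dist_norm norm_minus_commute)
        have ne: "norm ((3 / 2 * R) *\<^sub>R e) = 3 / 2 * R" using e R by simp
        have x_upper: "norm x \<le> 2 * R"
          using norm_triangle_ineq [of "(3 / 2 * R) *\<^sub>R e" u] ne u unfolding x by linarith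
        have x_lower: "R \<le> norm x"
          using norm_diff_ineq [of "(3 / 2 * R) *\<^sub>R e" u] ne u unfolding x by linarith
        have "e \<bullet> e = 1" using e by (simp add: norm_eq_1)
        then have "x \<bullet> e = 3 / 2 * R + u \<bullet> e" by (simp add: x inner_add_left)
        moreover have "\<bar>u \<bullet> e\<bar> \<le> R / 2"
          using Cauchy_Schwarz_ineq2 [of u e] e u by simp
        ultimately have "R \<le> x \<bullet> e" "x \<bullet> e \<le> 2 * R" by linarith+
        then have angle: "1 \<le> (x \<bullet> e) * (1 / R)" "(x \<bullet> e) * (1 / R) \<le> 2"
          using R by (simp_all add: divide_simps)
        have "1 / 2 \<le> sin ((x \<bullet> e) * (1 / R))"
        proof -
          \<comment> \<open>The interval from 1 to 2 lies within \<open>pi / 3\<close> of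
            \<open>pi / 2\<close>, so the sine there is at least
            \<open>cos (pi / 3) = 1 / 2\<close>.\<close>
          have "\<bar>(x \<bullet> e) * (1 / R) - pi / 2\<bar> \<le> pi / 3"
            using angle pi_gt3 pi_less_4 by linarith
          then have "cos (pi / 3) \<le> cos \<bar>(x \<bullet> e) * (1 / R) - pi / 2\<bar>"
            by (intro cos_monotone_0_pi_le) auto
          also have "\<dots> = sin ((x \<bullet> e) * (1 / R))"
            by (simp add: cos_diff)
          finally show ?thesis by (simp add: cos_60)
        qed
        then have "1 / 4 \<le> sin ((x \<bullet> e) * (1 / R)) - a" using a by linarith
        then have "(1 / 4)\<^sup>2 \<le> (sin ((x \<bullet> e) * (1 / R)) - a)\<^sup>2"
          by (intro power_mono) auto
        then have s: "1 / 16 \<le> (sin ((x \<bullet> e) * (1 / R)) - a)\<^sup>2" by (simp add: power2_eq_square)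
        \<comment> \<open>\<open>1 + norm x \<le> 3 * R\<close>, because
          \<open>norm x \<le> 2 * R\<close> and \<open>1 \<le> R\<close>.\<close>
        have "(3 * R) powr (- p) \<le> (1 + norm x) powr (- p)"
          using x_upper R p by (intro powr_mono2') (auto simp: add_pos_nonneg)
        then have "1 / 16 * (3 * R) powr (- p) \<le> (sin ((x \<bullet> e) * (1 / R)) - a)\<^sup>2 * (1 + norm x) powr (- p)"
          using s by (intro mult_mono) auto
        then have "(1 / 16 * (3 * R) powr (- p)) / ZV V \<le> ((sin ((x \<bullet> e) * (1 / R)) - a)\<^sup>2 * (1 + norm x) powr (- p)) / ZV V"
          using Z by (intro divide_right_mono) auto
        then show ?thesis using True x_lower
          by (simp add: p_def n_def ennreal_leI)
      qed simp
    qed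
    also have "\<dots> = (\<integral>\<^sup>+ x. ennreal ((sin ((x \<bullet> e) * (1 / R)) - a)\<^sup>2 * indicator {x. R \<le> norm x} x * omega \<alpha> V x) \<partial>muV V)"
      by (intro nn_integral_omega_muV [symmetric] int V) auto
    finally show ?thesis .
  qed
  with k show ?thesis by blast
qed

text \<open>Energy and weighted variance of the sine wave have the same order
  \<open>R powr (- \<alpha>)\<close>, so a weight exceeding a large multiple of \<open>omega\<close>
  far out breaks the inequality for one large \<open>R\<close>.\<close>

lemma weight_optimal:
  fixes V :: "'a::euclidean_space \<Rightarrow> real" and \<omega>s :: "'a \<Rightarrow> real"
  assumes V [measurable]: "V \<in> borel_measurable borel"
    and int: "integrable lborel (\<lambda>x. exp (- V x))"
    and \<alpha>: "0 < \<alpha>" "\<alpha> < 2"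
    and lim: "Liminf at_infinity (\<lambda>x. ereal (\<omega>s x / omega \<alpha> V x)) = \<infinity>"
    and C: "0 < C"
    and ineq: "\<And>f. Cb_inf f \<Longrightarrow>
      (\<integral>\<^sup>+ x. ennreal ((f x - muV_f V f)\<^sup>2 * \<omega>s x) \<partial>muV V) \<le> ennreal C * D_form \<alpha> V f"
  shows False
proof -
  obtain e :: 'a where "e \<in> Basis" using nonempty_Basis by blast
  then have e: "norm e = 1" by simp
  obtain K where K: "0 < K"
    and D: "\<And>R. 0 < R \<Longrightarrow> D_form \<alpha> V (\<lambda>x. sin ((x \<bullet> e) * (1 / R))) \<le> ennreal (K * R powr (- \<alpha>))"
    using D_form_sin_le [OF V int \<alpha> e] by blast
  obtain k where k: "0 < k"
    and lower: "\<And>R a. 1 \<le> R \<Longrightarrow> \<bar>a\<bar> \<le> 1 / 4 \<Longrightarrow> ennreal (k * R powr (- \<alpha>))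
      \<le> (\<integral>\<^sup>+ x. ennreal ((sin ((x \<bullet> e) * (1 / R)) - a)\<^sup>2 * indicator {x. R \<le> norm x} x * omega \<alpha> V x) \<partial>muV V)"
    using centred_sin_lower_bound [OF V int \<alpha>(1) e] by blast
  \<comment> \<open>Chosen so that \<open>M * k = C * K + k\<close>, strictly more than
    \<open>C * K\<close>.\<close>
  define M where "M = C * K / k + 1"
  have M: "0 < M" using C K k by (simp add: M_def add_pos_pos)
  have omega_pos: "0 < omega \<alpha> V x" for x
    unfolding omega_def by (smt (verit) divide_pos_pos exp_gt_zero norm_ge_zero powr_gt_zero)
  have [measurable]: "omega \<alpha> V \<in> borel_measurable borel"
    unfolding omega_def [abs_def] by measurable
  have "eventually (\<lambda>x. ereal M < ereal (\<omega>s x / omega \<alpha> V x)) at_infinity"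
    by (rule less_LiminfD) (simp add: lim)
  then obtain r where r: "\<And>x. r \<le> norm x \<Longrightarrow> M < \<omega>s x / omega \<alpha> V x"
    by (auto simp: eventually_at_infinity)
  have "eventually (\<lambda>R. \<bar>muV_f V (\<lambda>x. sin ((x \<bullet> e) * (1 / R)))\<bar> < 1 / 4) at_top"
    using tendstoD [OF muV_f_sin_tendsto_0 [OF V int, of e], of "1 / 4"] by simp
  \<comment> \<open>One \<open>R\<close> has to make the mean small, satisfy
    \<open>1 \<le> R\<close> for \<open>lower\<close>, and reach the region where
    \<open>\<omega>s\<close> exceeds \<open>M\<close> times \<open>omega\<close>.\<close>
  then have "eventually (\<lambda>R. \<bar>muV_f V (\<lambda>x. sin ((x \<bullet> e) * (1 / R)))\<bar> < 1 / 4 \<and> 1 \<le> R \<and> r \<le> R) at_top"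
    by (intro eventually_conj eventually_ge_at_top)
  then obtain R where R: "\<bar>muV_f V (\<lambda>x. sin ((x \<bullet> e) * (1 / R)))\<bar> < 1 / 4" "1 \<le> R" "r \<le> R"
    by (auto simp: eventually_at_top_linorder)
  define f where "f = (\<lambda>x. sin ((x \<bullet> e) * (1 / R)))"
  define a where "a = muV_f V f"
  have "ennreal (M * (k * R powr (- \<alpha>))) = ennreal M * ennreal (k * R powr (- \<alpha>))"
    using M by (simp add: ennreal_mult')
  also have "\<dots> \<le> ennreal M * (\<integral>\<^sup>+ x. ennreal ((f x - a)\<^sup>2 * indicator {x. R \<le> norm x} x * omega \<alpha> V x) \<partial>muV V)"
    unfolding f_def a_def using R by (intro mult_left_mono lower) auto
  also have "\<dots> = (\<integral>\<^sup>+ x. ennreal M * ennreal ((f x - a)\<^sup>2 * indicator {x. R \<le> norm x} x * omega \<alpha> V x) \<partial>muV V)"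
    by (intro nn_integral_cmult [symmetric]) (auto simp: f_def)
  also have "\<dots> \<le> (\<integral>\<^sup>+ x. ennreal ((f x - a)\<^sup>2 * \<omega>s x) \<partial>muV V)"
  proof (intro nn_integral_mono)
    fix x
    show "ennreal M * ennreal ((f x - a)\<^sup>2 * indicator {x. R \<le> norm x} x * omega \<alpha> V x) \<le> ennreal ((f x - a)\<^sup>2 * \<omega>s x)"
    proof (cases "R \<le> norm x")
      case True
      then have "M * omega \<alpha> V x \<le> \<omega>s x"
        using r [of x] R omega_pos [of x] by (simp add: less_divide_eq less_imp_le)
      then have "(f x - a)\<^sup>2 * (M * omega \<alpha> V x) \<le> (f x - a)\<^sup>2 * \<omega>s x"
        by (intro mult_left_mono) auto
      then show ?thesis
        using True M by (subst ennreal_mult' [symmetric]) (auto simp: ac_simps intro!: ennreal_leI)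
    qed simp
  qed
  also have "\<dots> \<le> ennreal C * D_form \<alpha> V f"
    unfolding a_def by (rule ineq) (simp add: f_def Cb_inf_sin del: times_divide_eq_left times_divide_eq_right)
  also have "\<dots> \<le> ennreal C * ennreal (K * R powr (- \<alpha>))"
    unfolding f_def using R by (intro mult_left_mono D) auto
  also have "\<dots> = ennreal (C * (K * R powr (- \<alpha>)))"
    using C by (simp add: ennreal_mult')
  finally have "M * (k * R powr (- \<alpha>)) \<le> C * (K * R powr (- \<alpha>))"
    using C K by (subst (asm) ennreal_le_iff) auto
  moreover have "0 < R powr (- \<alpha>)" using R by simp
  ultimately have "M * k \<le> C * K" by (simp add: mult.assoc [symmetric])
  moreover have "M * k = C * K + k" using k by (simp add: M_def field_simps)
  ultimately show False using k by simp
qed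

section \<open>The inequality and the optimality of its weight combined\<close>

theorem theorem1p4:
  fixes V :: "'a::euclidean_space \<Rightarrow> real" and \<alpha> \<alpha>0 :: real
  assumes V_meas: "V \<in> borel_measurable borel"
    and V_locbdd: "\<And>K. compact K \<Longrightarrow> bounded (V ` K)"
    and expV_bdd: "bounded (range (\<lambda>x. exp (- V x)))"
    and expV_int: "integrable lborel (\<lambda>x. exp (- V x))"
    and \<alpha>: "0 < \<alpha>" "\<alpha> < 2"
    and \<alpha>0: "0 < \<alpha>0" "\<alpha>0 < \<alpha> / 2"
    and tail: "Limsup at_infinity
       (\<lambda>x::'a. ereal ((SUP z\<in>{z. norm z \<ge> norm x}. exp (- V z)) * norm x powr (real DIM('a) + \<alpha> - \<alpha>0))) = 0"
  shows "(\<exists>C2>0. \<forall>f. Cb_inf f \<longrightarrow>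
            (\<integral>\<^sup>+ x. ennreal ((f x - muV_f V f)\<^sup>2 * omega \<alpha> V x) \<partial>muV V)
              \<le> ennreal C2 * D_form \<alpha> V f)
       \<and> (\<forall>\<omega>s :: 'a \<Rightarrow> real. \<omega>s \<in> borel_measurable borel \<longrightarrow> (\<forall>x. 0 < \<omega>s x) \<longrightarrow>
            Liminf at_infinity (\<lambda>x. ereal (\<omega>s x / omega \<alpha> V x)) = \<infinity> \<longrightarrow>
            \<not> (\<exists>C>0. \<forall>f. Cb_inf f \<longrightarrow>
                 (\<integral>\<^sup>+ x. ennreal ((f x - muV_f V f)\<^sup>2 * \<omega>s x) \<partial>muV V)
                   \<le> ennreal C * D_form \<alpha> V f))"
proof -
  have s: "0 < real DIM('a) + \<alpha> - \<alpha>0"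
    using \<alpha> \<alpha>0 by (simp add: algebra_simps add_nonneg_pos)
  obtain M where "\<And>x. exp (- V x) \<le> M * (1 + norm x) powr (- (real DIM('a) + \<alpha> - \<alpha>0))"
    using weight_pointwise_bound [OF expV_bdd s tail] by blast
  then obtain C2 where "0 < C2" "\<And>f. f \<in> borel_measurable borel \<Longrightarrow> bounded (range f) \<Longrightarrow>
    (\<integral>\<^sup>+ x. ennreal ((f x - muV_f V f)\<^sup>2 * omega \<alpha> V x) \<partial>muV V) \<le> ennreal C2 * D_form \<alpha> V f"
    using weighted_Poincare [OF V_meas expV_int \<alpha>(1) \<alpha>0(2)] by blast
  \<comment> \<open>Functions in \<open>Cb_inf\<close> are measurable and bounded, as the inequality
    for \<open>C2\<close> requires.\<close>
  then show ?thesis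
    using weight_optimal [OF V_meas expV_int \<alpha>] by (blast intro: Cb_inf_measurable Cb_inf_bounded)
qed

end
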